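(* Let $W$ be an irreducible $T$-module with endpoint $r$ and diameter $d=D-2r$. Then the following hold. (i) For a nonzero $u\in E_rW$, each of the two sequences $$E^*_ru,\,E^*_{r+1}u,\ldots,E^*_{r+d}u;\qquad\qquad E^{\varepsilon}_ru,\,E^{\varepsilon}_{r+1}u,\ldots,E^{\varepsilon}_{r+d}u$$ is a basis for $W$. (ii) For a nonzero $u^*\in E^*_rW$, each of the two sequences $$E^{\varepsilon}_ru^*,\,E^{\varepsilon}_{r+1}u^*,\ldots,E^{\varepsilon}_{r+d}u^*;\qquad\qquad E_ru^*,\,E_{r+1}u^*,\ldots,E_{r+d}u^*$$ is a basis for $W$. (iii) For a nonzero $u^{\varepsilon}\in E^{\varepsilon}_rW$, each of the two sequences $$E_ru^{\varepsilon},\,E_{r+1}u^{\varepsilon},\ldots,E_{r+d}u^{\varepsilon};\qquad\qquad E^*_ru^{\varepsilon},\,E^*_{r+1}u^{\varepsilon},\ldots,E^*_{r+d}u^{\varepsilon}$$ is a basis for $W$.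
   Context: Let $D$ be a positive integer and let $Q_D$ be the $D$-cube: the graph with vertex set $X=\{0,1\}^D$, two vertices being adjacent iff they differ in exactly one coordinate; $\partial$ denotes path-length distance. $\mathrm{Mat}_X(\mathbb{C})$ is the algebra of complex matrices with rows and columns indexed by $X$, acting on $V=\mathbb{C}^X$ (column vectors) by left multiplication. Write $\mathbf{i}^2=-1$. Let $A$ be the adjacency matrix of $Q_D$. Fix $x=(0,0,\ldots,0)\in X$. Let $A^*$ be the diagonal matrix in $\mathrm{Mat}_X(\mathbb{C})$ with $(y,y)$-entry $D-2\partial(x,y)$ for $y\in X$, and let $A^{\varepsilon}=-\mathbf{i}(AA^*-A^*A)/2$. Let $T$ be the subalgebra of $\mathrm{Mat}_X(\mathbb{C})$ generated by $A$ and $A^*$. The eigenvalues of $A$ are $\theta_i=D-2i$ $(0\le i\le D)$. For $0\le i\le D$: $E_i=\prod_{0\le j\le D,\,j\ne i}\frac{A-\theta_jI}{\theta_i-\theta_j}$ is the primitive idempotent of $A$ for $\theta_i$ (the orthogonal projection onto the $\theta_i$-eigenspace of $A$); $E_i^*$ is the diagonal matrix with $(y,y)$-entry $1$ if $\partial(x,y)=i$ and $0$ otherwise; and $E_i^{\varepsilon}=P^{-1}E_iP$, where $P=P_1^{\otimes D}$ (Kronecker power, $P_{yz}=\prod_{k=1}^D(P_1)_{y_kz_k}$, invertible) with $P_1=\begin{pmatrix}1&1\\-\mathbf{i}&\mathbf{i}\end{pmatrix}$, rows and columns indexed by $0,1$ in that order. ($E_i^*$ and $E_i^{\varepsilon}$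 are the primitive idempotents of $A^*$ and $A^{\varepsilon}$ for the eigenvalue $D-2i$.) A $T$-module is a subspace $W\subseteq V$ with $BW\subseteq W$ for all $B\in T$; it is irreducible if $W\ne0$ and it contains no $T$-modules other than $0$ and $W$. The endpoint of an irreducible $T$-module $W$ is $r=\min\{i\mid 0\le i\le D,\ E_i^*W\neq0\}$ (it is known that also $r=\min\{i\mid E_iW\ne0\}$), and its diameter is $d=|\{i\mid 0\le i\le D,\ E_i^*W\ne0\}|-1$; it is known that $d=D-2r$ and $0\le r\le D/2$. *)

theory Defs
  imports "HOL-Analysis.Analysis"
begin

text \<open>
  The dimension \<open>D\<close> is \<open>CARD('n)\<close> for an arbitrary finite index type \<open>'n\<close>; since types are nonempty,
  this ranges over exactly the positive integers. The alphabet \<open>{0, 1}\<close> is the two-element numeral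
  type \<open>2\<close>, so \<open>X = {0, 1}\<^sup>D\<close> is the type \<open>2 ^ 'n\<close> and the base vertex \<open>(0, \<dots>, 0)\<close> is \<open>0\<close>.
\<close>

type_synonym 'n vertex = "2 ^ 'n"
type_synonym 'n cvector = "complex ^ 'n vertex"
type_synonym 'n cmatrix = "complex ^ 'n vertex ^ 'n vertex"

definition cube_adj :: "('n::finite) vertex \<Rightarrow> 'n vertex \<Rightarrow> bool" where
  "cube_adj y z \<longleftrightarrow> card {k. y $ k \<noteq> z $ k} = 1"

definition cube_dist :: "('n::finite) vertex \<Rightarrow> 'n vertex \<Rightarrow> nat" where
  "cube_dist y z = (LEAST m. (cube_adj ^^ m) y z)"

definition adj_mat :: "('n::finite) cmatrix" where
  "adj_mat = (\<chi> y z. if cube_adj y z then 1 else 0)"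

definition theta :: "('n::finite) itself \<Rightarrow> nat \<Rightarrow> complex" where
  "theta _ i = of_nat CARD('n) - 2 * of_nat i"

definition dual_adj_mat :: "('n::finite) cmatrix" where
  "dual_adj_mat = (\<chi> y z. if y = z then theta TYPE('n) (cube_dist 0 y) else 0)"

definition mat_scale :: "complex \<Rightarrow> ('n::finite) cmatrix \<Rightarrow> 'n cmatrix" where
  "mat_scale c M = (\<chi> y z. c * M $ y $ z)"

text \<open>
  The product over \<open>j \<noteq> i\<close> is a product of matrices with respect to \<open>(**)\<close>; the operation \<open>(*)\<close> on
  the type of matrices, hence \<open>prod\<close>, is entrywise. The factors commute.
\<close>

definition E :: "nat \<Rightarrow> ('n::finite) cmatrix" where
  "E i = foldr (**)
     (map (\<lambda>j. mat_scale (1 / (theta TYPE('n) i - theta TYPE('n) j))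
                 (adj_mat - mat (theta TYPE('n) j)))
       (filter (\<lambda>j. j \<noteq> i) [0..<CARD('n) + 1]))
     (mat 1)"

definition E_star :: "nat \<Rightarrow> ('n::finite) cmatrix" where
  "E_star i = (\<chi> y z. if y = z \<and> cube_dist 0 y = i then 1 else 0)"

text \<open>
  \<open>P1\<close> has rows \<open>(1, 1)\<close> and \<open>(-\<i>, \<i>)\<close>, indexed by \<open>0, 1\<close> in that order. The function \<open>vector\<close> is not
  used because it enumerates the indices of type \<open>2\<close> as \<open>1, 2\<close>, where \<open>2 = 0\<close>.
\<close>

definition P1 :: "complex ^ 2 ^ 2" where
  "P1 = (\<chi> a b. if a = 0 then 1 else if b = 0 then - \<i> else \<i>)"

definition P :: "('n::finite) cmatrix" where
  "P = (\<chi> y z. \<Prod>k\<in>UNIV. P1 $ (y $ k) $ (z $ k))"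

text \<open>
  Conjugation by \<open>P\<close> carries \<open>A\<close> to \<open>A\<^sup>\<epsilon> = - \<i> (A A\<^sup>* - A\<^sup>* A) / 2\<close>, whose primitive idempotent for the
  eigenvalue \<open>D - 2 i\<close> is therefore \<open>P\<^sup>-\<^sup>1 E\<^sub>i P\<close>.
\<close>

definition E_eps :: "nat \<Rightarrow> ('n::finite) cmatrix" where
  "E_eps i = matrix_inv P ** E i ** P"

definition is_subalgebra :: "('n::finite) cmatrix set \<Rightarrow> bool" where
  "is_subalgebra S \<longleftrightarrow>
     mat 1 \<in> S \<and>
     (\<forall>M\<in>S. \<forall>N\<in>S. M + N \<in> S \<and> M ** N \<in> S) \<and>
     (\<forall>c. \<forall>M\<in>S. mat_scale c M \<in> S)"

definition T_alg :: "('n::finite) cmatrix set" where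
  "T_alg = is_subalgebra hull {adj_mat, dual_adj_mat}"

text \<open>\<open>vec.subspace\<close>, \<open>vec.span\<close> and \<open>vec.independent\<close> refer to complex scalars, acting by \<open>(*s)\<close>.\<close>

definition T_module :: "('n::finite) cvector set \<Rightarrow> bool" where
  "T_module W \<longleftrightarrow> vec.subspace W \<and> (\<forall>B\<in>T_alg. \<forall>w\<in>W. B *v w \<in> W)"

definition irreducible_T_module :: "('n::finite) cvector set \<Rightarrow> bool" where
  "irreducible_T_module W \<longleftrightarrow>
     T_module W \<and> W \<noteq> {0} \<and> (\<forall>U. T_module U \<and> U \<subseteq> W \<longrightarrow> U = {0} \<or> U = W)"

definition mat_image :: "('n::finite) cmatrix \<Rightarrow> 'n cvector set \<Rightarrow> 'n cvector set" where
  "mat_image M W = (\<lambda>w. M *v w) ` W"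

definition module_support :: "('n::finite) cvector set \<Rightarrow> nat set" where
  "module_support W = {i. i \<le> CARD('n) \<and> mat_image (E_star i) W \<noteq> {0}}"

definition module_endpoint :: "('n::finite) cvector set \<Rightarrow> nat" where
  "module_endpoint W = Min (module_support W)"

definition module_diameter :: "('n::finite) cvector set \<Rightarrow> nat" where
  "module_diameter W = card (module_support W) - 1"

definition is_basis :: "('n::finite) cvector list \<Rightarrow> 'n cvector set \<Rightarrow> bool" where
  "is_basis vs W \<longleftrightarrow> distinct vs \<and> vec.independent (set vs) \<and> vec.span (set vs) = W"

end

theory Submission
  imports Defs
begin

text \<open>
  Conjugation by \<open>P\<close> permutes \<open>A\<^sup>\<epsilon>, A, A\<^sup>*\<close> cyclically, so the three matrices satisfy the
  \<open>sl\<^sub>2\<close> relations \<open>[A, A\<^sup>*] = 2\<i>A\<^sup>\<epsilon>\<close>, \<open>[A\<^sup>*, A\<^sup>\<epsilon>] = 2\<i>A\<close>, \<open>[A\<^sup>\<epsilon>, A] = 2\<i>A\<^sup>*\<close> and play symmetric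
  roles. Let \<open>X, Y, Z\<close> be these matrices in some order and \<open>u \<in> W\<close> a nonzero vector of highest weight
  for \<open>X\<close>. The raising operator for \<open>X\<close>, a combination of \<open>Y\<close> and \<open>Z\<close>, kills \<open>u\<close>, so \<open>Zu\<close> is a multiple
  of \<open>Yu\<close>; then the commutation relations make \<open>\<complex>[Y]u\<close> invariant under \<open>X\<close> and \<open>Z\<close>, hence equal to
  \<open>W\<close>. So the nonzero projections of \<open>u\<close> to the eigenspaces of \<open>Y\<close> form a basis of \<open>W\<close>, and in particular
  \<open>dim W\<close> is the number of weights of \<open>Y\<close> on \<open>W\<close>. Applying the lowering operator to \<open>u\<close> repeatedly
  shows that the weights of \<open>X\<close> on \<open>W\<close> are those with index in \<open>{r..D - r}\<close>; comparing dimensions, \<open>r\<close>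
  is the same for all three matrices.
\<close>

section \<open>Eigenvectors and spectral decompositions of one matrix\<close>

text \<open>Applying \<open>X - t j\<close> to the sum removes the summand for \<open>j\<close> and
  multiplies the others by nonzero scalars, so induction on \<open>I\<close> applies. With
  \<open>W = {0}\<close> this is the independence of eigenspaces.\<close>

lemma eigenvector_components:
  fixes X :: "complex ^ 'm ^ 'm"
  assumes "finite I" "inj_on t I"
    and "vec.subspace W" "\<And>w. w \<in> W \<Longrightarrow> X *v w \<in> W"
    and "\<And>i. i \<in> I \<Longrightarrow> X *v f i = t i *s f i" "(\<Sum>i\<in>I. f i) \<in> W" "i \<in> I"
  shows "f i \<in> W"
  using assms(1,2,5-)
proof (induction I arbitrary: f i rule: finite_induct)
  case empty
  then show ?case by simp
next
  case (insert j I)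
  have sub: "(t k - t j) *s f k \<in> W" if "k \<in> I" for k
  proof (rule insert.IH[of "\<lambda>k. (t k - t j) *s f k"])
    show "inj_on t I" using insert.prems(1) by simp
    show "X *v ((t k - t j) *s f k) = t k *s ((t k - t j) *s f k)" if "k \<in> I" for k
      using that unfolding vector_scalar_commute insert.prems(2)[OF insertI2[OF that]]
      by (simp only: vector_smult_assoc mult.commute)
    have "X *v (\<Sum>i\<in>insert j I. f i) - t j *s (\<Sum>i\<in>insert j I. f i)
        = (\<Sum>i\<in>insert j I. t i *s f i - t j *s f i)"
      using insert.prems(2) by (simp add: vec.linear_sum[OF matrix_vector_mul_linear_gen] vec.scale_sum_right sum_subtractf
          del: sum.insert)
    also have "\<dots> = (\<Sum>i\<in>I. (t i - t j) *s f i)"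
      using insert.hyps by (simp add: vec.scale_left_diff_distrib)
    finally show "(\<Sum>i\<in>I. (t i - t j) *s f i) \<in> W"
      using assms(3,4) insert.prems(3) by (metis vec.subspace_diff vec.subspace_scale)
  qed (use that in auto)
  have I: "f k \<in> W" if "k \<in> I" for k
  proof -
    have "t k \<noteq> t j" using insert.prems(1) insert.hyps(2) that by (metis inj_on_contraD insertCI)
    then have "1 / (t k - t j) * (t k - t j) = 1" by simp
    then have "f k = (1 / (t k - t j)) *s ((t k - t j) *s f k)"
      by (simp only: vector_smult_assoc vector_smult_lid)
    then show ?thesis using sub[OF that] assms(3) by (metis vec.subspace_scale)
  qed
  have "f j = (\<Sum>i\<in>insert j I. f i) - (\<Sum>i\<in>I. f i)" using insert.hyps by simp
  also have "\<dots> \<in> W"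
    by (intro vec.subspace_diff vec.subspace_sum assms(3) insert.prems(3) I)
  finally show ?case using I insert.prems(4) by auto
qed

text \<open>Same values as \<open>theta\<close>, but with the dimension as a number instead of a
  type, which separates the algebra from the cube.\<close>

definition weight :: "nat \<Rightarrow> nat \<Rightarrow> complex" where
  "weight N i = of_nat N - 2 * of_nat i"

lemma weight_eq_iff [simp]: "weight N i = weight N j \<longleftrightarrow> i = j"
  by (simp add: weight_def)

definition support :: "nat \<Rightarrow> (nat \<Rightarrow> complex ^ 'm ^ 'm) \<Rightarrow> (complex ^ 'm) set \<Rightarrow> nat set" where
  "support N F W = {i. i \<le> N \<and> (\<exists>w\<in>W. F i *v w \<noteq> 0)}"

text \<open>Idempotence and orthogonality of the \<open>F i\<close> follow from these two
  assumptions, see \<open>F_F\<close>.\<close>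

locale spectral =
  fixes N :: nat and X :: "complex ^ 'm ^ 'm" and F :: "nat \<Rightarrow> complex ^ 'm ^ 'm"
  assumes sum_F: "(\<Sum>i\<le>N. F i *v v) = v"
    and X_F: "i \<le> N \<Longrightarrow> X *v (F i *v v) = weight N i *s (F i *v v)"
begin

lemma F_invariant:
  assumes "vec.subspace W" "\<And>w. w \<in> W \<Longrightarrow> X *v w \<in> W" "w \<in> W" "i \<le> N"
  shows "F i *v w \<in> W"
  using eigenvector_components[of "{..N}" "weight N" W X "\<lambda>i. F i *v w" i] assms
  by (simp add: sum_F X_F inj_on_def)

text \<open>The vectors \<open>F k *v v\<close>, with \<open>v\<close> subtracted at
  \<open>k = j\<close>, are eigenvectors for distinct eigenvalues and sum to zero, so each is
  zero.\<close>

lemma eigenvector_F: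
  assumes "X *v v = weight N j *s v" "i \<le> N"
  shows "F i *v v = (if i = j then v else 0)"
proof -
  \<comment> \<open>\<open>j\<close> may exceed \<open>N\<close>; then \<open>f j\<close> is
    \<open>- v\<close>.\<close>
  let ?I = "insert j {..N}"
  define f where "f k = (if k \<le> N then F k *v v else 0) - (if k = j then v else 0)" for k
  have "(\<Sum>k\<in>?I. if k \<le> N then F k *v v else 0) = (\<Sum>k\<le>N. F k *v v)"
    by (rule sum.mono_neutral_cong_right) auto
  then have "(\<Sum>k\<in>?I. f k) = 0"
    by (simp add: f_def sum_subtractf sum_F sum.delta' del: sum.insert)
  moreover have "X *v f k = weight N k *s f k" for k
    using assms(1) by (auto simp: f_def matrix_vector_mult_diff_distrib X_F vec.scale_right_diff_distrib)
  ultimately have "f i \<in> {0}"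
    using assms(2) by (intro eigenvector_components[of ?I "weight N" "{0}" X f])
      (auto simp: inj_on_def)
  then show ?thesis using assms(2) by (auto simp: f_def split: if_splits)
qed

lemma F_F: "i \<le> N \<Longrightarrow> j \<le> N \<Longrightarrow> F i *v (F j *v v) = (if i = j then F j *v v else 0)"
  by (rule eigenvector_F) (simp_all add: X_F)

lemma eigenvector_high_zero:
  assumes "X *v v = weight N j *s v" "j > N"
  shows "v = 0"
proof -
  have "(\<Sum>i\<le>N. F i *v v) = 0"
    using assms eigenvector_F[OF assms(1)] by (intro sum.neutral) auto
  then show ?thesis by (simp add: sum_F)
qed

text \<open>\<open>F i\<close> kills the projections of \<open>u\<close> with other indices. So if
  \<open>F i *v u = 0\<close>, then \<open>F i\<close> kills all of \<open>W\<close>; hence the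
  support consists of the \<open>i\<close> with \<open>F i *v u\<close> nonzero, and these
  projections are independent.\<close>

lemma cyclic_basis:
  assumes W: "vec.subspace W" "\<And>w. w \<in> W \<Longrightarrow> X *v w \<in> W"
    and span: "vec.span ((\<lambda>i. F i *v u) ` {..N}) = W"
  shows "inj_on (\<lambda>i. F i *v u) (support N F W)" (is "inj_on ?f ?S")
    and "vec.independent ((\<lambda>i. F i *v u) ` support N F W)"
    and "vec.span ((\<lambda>i. F i *v u) ` support N F W) = W"
    and "vec.dim W = card (support N F W)"
proof -
  have supp: "i \<in> ?S \<longleftrightarrow> ?f i \<noteq> 0" if i: "i \<le> N" for i
  proof
    assume "i \<in> ?S"
    then obtain w where w: "w \<in> W" "F i *v w \<noteq> 0" by (auto simp: support_def)
    show "?f i \<noteq> 0"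
    proof
      assume 0: "?f i = 0"
      have "vec.subspace {w. F i *v w = 0}"
        by (auto simp: vec.subspace_def matrix_vector_right_distrib vector_scalar_commute)
      moreover have "?f ` {..N} \<subseteq> {w. F i *v w = 0}"
        using i 0 by (auto simp: F_F)
      ultimately have "W \<subseteq> {w. F i *v w = 0}" using span vec.span_minimal by blast
      then show False using w by blast
    qed
  next
    assume "?f i \<noteq> 0"
    moreover have "?f i \<in> W" using span i vec.span_base[of "?f i" "?f ` {..N}"] by simp
    moreover have "F i *v ?f i = ?f i" using F_F[OF i i] by simp
    ultimately show "i \<in> ?S" using i unfolding support_def by (intro CollectI conjI bexI[of _ "?f i"]) simp_all
  qed
  have S: "?S \<subseteq> {..N}" by (auto simp: support_def)
  show inj: "inj_on ?f ?S"
  proof (rule inj_onI, rule ccontr)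
    fix i j assume ij: "i \<in> ?S" "j \<in> ?S" "?f i = ?f j" "i \<noteq> j"
    then have "i \<le> N" "j \<le> N" using S by auto
    then have "?f i = 0" using ij F_F[of i i u] F_F[of i j u] by simp
    then show False using supp ij \<open>i \<le> N\<close> by simp
  qed
  show ind: "vec.independent (?f ` ?S)"
  proof (rule vec.independent_if_scalars_zero)
    have fS: "finite ?S" by (simp add: support_def)
    then show "finite (?f ` ?S)" by simp
    fix g x assume g: "(\<Sum>v\<in>?f ` ?S. g v *s v) = 0" "x \<in> ?f ` ?S"
    then obtain i where i: "i \<in> ?S" "x = ?f i" by blast
    have "0 = F i *v (\<Sum>v\<in>?f ` ?S. g v *s v)" using g by simp
    also have "\<dots> = (\<Sum>j\<in>?S. g (?f j) *s (F i *v ?f j))"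
      using inj by (simp add: sum.reindex vec.linear_sum[OF matrix_vector_mul_linear_gen] vector_scalar_commute)
    also have "\<dots> = (\<Sum>j\<in>?S. if j = i then g x *s x else 0)"
      using S i by (intro sum.cong refl) (auto simp: F_F subset_eq)
    also have "\<dots> = g x *s x" using i fS by simp
    finally show "g x = 0" using i supp S by auto
  qed
  have "?f ` {..N} \<subseteq> insert 0 (?f ` ?S)" using supp by auto
  then have "W \<subseteq> vec.span (?f ` ?S)" using span by (metis vec.span_insert_0 vec.span_mono)
  moreover have "vec.span (?f ` ?S) \<subseteq> W" using S span by (metis image_mono vec.span_mono)
  ultimately show sp: "vec.span (?f ` ?S) = W" by blast
  show "vec.dim W = card ?S"
    using vec.dim_eq_card[OF _ ind] sp card_image[OF inj] vec.span_span by metis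
qed

end

section \<open>Irreducible modules for \<open>sl2\<close> relations\<close>

text \<open>The scalar \<open>c\<close> is \<open>2 * \<i>\<close> or its negative. Fixing only its
  square lets every ordering of the three matrices be an instance.\<close>

locale sl2_module =
  X: spectral N X FX + Y: spectral N Y FY + Z: spectral N Z FZ
  for N :: nat and X Y Z :: "complex ^ 'm ^ 'm" and FX FY FZ :: "nat \<Rightarrow> complex ^ 'm ^ 'm" +
  fixes c :: complex and W :: "(complex ^ 'm) set"
  assumes c2: "c * c = - 4"
    and XY: "X *v (Y *v v) - Y *v (X *v v) = c *s (Z *v v)"
    and YZ: "Y *v (Z *v v) - Z *v (Y *v v) = c *s (X *v v)"
    and ZX: "Z *v (X *v v) - X *v (Z *v v) = c *s (Y *v v)"
    and subspace: "vec.subspace W"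
    and invariant: "w \<in> W \<Longrightarrow> X *v w \<in> W" "w \<in> W \<Longrightarrow> Y *v w \<in> W" "w \<in> W \<Longrightarrow> Z *v w \<in> W"
    and nonzero: "W \<noteq> {0}"
    and irreducible: "vec.subspace U \<Longrightarrow> U \<subseteq> W \<Longrightarrow> (\<And>w. w \<in> U \<Longrightarrow> X *v w \<in> U) \<Longrightarrow>
      (\<And>w. w \<in> U \<Longrightarrow> Y *v w \<in> U) \<Longrightarrow> (\<And>w. w \<in> U \<Longrightarrow> Z *v w \<in> U) \<Longrightarrow> U = {0} \<or> U = W"
begin

lemma rotate: "sl2_module N Y Z X FY FZ FX c W"
proof unfold_locales
  fix U assume "vec.subspace U" "U \<subseteq> W" "\<And>w. w \<in> U \<Longrightarrow> Y *v w \<in> U"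
    "\<And>w. w \<in> U \<Longrightarrow> Z *v w \<in> U" "\<And>w. w \<in> U \<Longrightarrow> X *v w \<in> U"
  then show "U = {0} \<or> U = W" by (intro irreducible)
qed (fact c2 XY YZ ZX subspace invariant nonzero)+

text \<open>Exchanging \<open>Y\<close> and \<open>Z\<close> negates all three commutators, which
  \<open>- c\<close> absorbs.\<close>

lemma reflect: "sl2_module N X Z Y FX FZ FY (- c) W"
proof unfold_locales
  fix v
  show "X *v (Z *v v) - Z *v (X *v v) = - c *s (Y *v v)"
    and "Z *v (Y *v v) - Y *v (Z *v v) = - c *s (X *v v)"
    and "Y *v (X *v v) - X *v (Y *v v) = - c *s (Z *v v)"
    unfolding vec.scale_minus_left XY[symmetric] YZ[symmetric] ZX[symmetric] by simp_all
next
  show "- c * - c = - 4" using c2 by simp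
next
  fix U assume "vec.subspace U" "U \<subseteq> W" "\<And>w. w \<in> U \<Longrightarrow> X *v w \<in> U"
    "\<And>w. w \<in> U \<Longrightarrow> Z *v w \<in> U" "\<And>w. w \<in> U \<Longrightarrow> Y *v w \<in> U"
  then show "U = {0} \<or> U = W" by (intro irreducible)
qed (fact subspace invariant nonzero)+

text \<open>Since \<open>c\<^sup>2 = -4\<close>, these satisfy \<open>[X, raise] = 2 raise\<close> and \<open>[X, lower] = -2 lower\<close>.\<close>

definition raise where "raise v = Y *v v + (c / 2) *s (Z *v v)"
definition lower where "lower v = Y *v v - (c / 2) *s (Z *v v)"

text \<open>Oriented as rewrite rules that sort products into the order \<open>Y\<close>,
  \<open>Z\<close>, \<open>X\<close>.\<close>

lemma X_Y: "X *v (Y *v v) = Y *v (X *v v) + c *s (Z *v v)"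
  and X_Z: "X *v (Z *v v) = Z *v (X *v v) - c *s (Y *v v)"
  and Z_Y: "Z *v (Y *v v) = Y *v (Z *v v) - c *s (X *v v)"
  using XY[of v] YZ[of v] ZX[of v] by (auto simp: algebra_simps)

lemma c_nz: "c \<noteq> 0" using c2 by auto

lemma c_half: "c * (c / 2) = - 2" "c / 2 * c = - 2" using c2 by auto

text \<open>Together with \<open>X\<close>, the halves of \<open>raise\<close> and
  \<open>lower\<close> form a standard \<open>sl2\<close> triple.\<close>

lemma X_raise: "X *v raise v = raise (X *v v) + 2 *s raise v"
  and X_lower: "X *v lower v = lower (X *v v) - 2 *s lower v"
  and raise_lower: "raise (lower v) = lower (raise v) + 4 *s (X *v v)"
  using c2
  by (simp_all add: raise_def lower_def X_Y X_Z Z_Y matrix_vector_right_distrib matrix_vector_mult_diff_distrib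
      vector_scalar_commute vec.scale_right_distrib vec.scale_right_diff_distrib c_half)
    (simp_all add: vec_eq_iff field_simps)

lemma raise_scale: "raise (a *s v) = a *s raise v"
  and lower_scale: "lower (a *s v) = a *s lower v"
  by (simp_all add: raise_def lower_def vector_scalar_commute vec.scale_right_distrib
      vec.scale_right_diff_distrib mult.commute)

lemma Y_eq: "Y *v v = (1 / 2) *s (raise v + lower v)"
  and Z_eq: "Z *v v = (1 / c) *s (raise v - lower v)"
  using c_nz by (simp_all add: raise_def lower_def vec_eq_iff field_simps)

lemma raise_W: "w \<in> W \<Longrightarrow> raise w \<in> W" and lower_W: "w \<in> W \<Longrightarrow> lower w \<in> W"
  using invariant subspace
  by (auto simp: raise_def lower_def intro!: vec.subspace_add vec.subspace_diff vec.subspace_scale)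

text \<open>Taken with respect to \<open>FX\<close>, so each rotated instance has its own endpoint
  until \<open>supports_eq\<close> identifies them.\<close>

definition endpoint where "endpoint = Min (support N FX W)"

lemma endpoint_support: "endpoint \<in> support N FX W"
proof -
  obtain w where w: "w \<in> W" "w \<noteq> 0" using nonzero subspace vec.subspace_0 by blast
  then obtain i where "i \<le> N" "FX i *v w \<noteq> 0"
    using X.sum_F[of w] sum.neutral[of "{..N}" "\<lambda>i. FX i *v w"] by (metis atMost_iff)
  then have "support N FX W \<noteq> {}" using w by (auto simp: support_def)
  then show ?thesis unfolding endpoint_def by (rule Min_in[rotated]) (simp add: support_def)
qed

text \<open>For positive \<open>endpoint\<close>, \<open>raise u\<close> has weight index
  \<open>endpoint - 1\<close>, which minimality excludes from the support.\<close>

lemma raise_highest: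
  assumes "u \<in> W" "X *v u = weight N endpoint *s u"
  shows "raise u = 0"
proof -
  have r: "endpoint \<le> N" using endpoint_support by (simp add: support_def)
  have eq: "X *v raise u = (weight N endpoint + 2) *s raise u"
    using assms by (simp add: X_raise raise_scale vec.scale_left_distrib)
  show ?thesis
  proof (cases endpoint)
    case 0
    \<comment> \<open>The eigenvalue \<open>N + 2\<close> is not a weight, so the weight components of \<open>raise u\<close> together with
      \<open>- raise u\<close> are eigenvectors for distinct eigenvalues with sum zero.\<close>
    let ?e = "\<lambda>k. if k \<le> N then weight N k else weight N 0 + 2"
    have "FX i *v raise u = 0" if "i \<le> N" for i
    proof -
      let ?f = "\<lambda>k. if k \<le> N then FX k *v raise u else - raise u"
      have "?f i \<in> {0}"
      proof (rule eigenvector_components[of "{..Suc N}" ?e "{0}" X])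
        have "weight N k \<noteq> weight N 0 + 2" for k
        proof
          assume "weight N k = weight N 0 + 2"
          then have "complex_of_nat (2 + k * 2) = 0" by (simp add: weight_def algebra_simps)
          then show False unfolding of_nat_eq_0_iff by simp
        qed
        then show "inj_on ?e {..Suc N}" unfolding inj_on_def by (auto simp: le_Suc_eq) metis
        show "X *v ?f k = ?e k *s ?f k" for k
          using eq 0 by (auto simp: X.X_F vec.linear_neg[OF matrix_vector_mul_linear_gen])
        show "(\<Sum>k\<le>Suc N. ?f k) \<in> {0}" using X.sum_F[of "raise u"] by simp
      qed (use that in auto)
      then show ?thesis using that by simp
    qed
    then show ?thesis using X.sum_F[of "raise u"] by simp
  next
    case (Suc k)
    then have "weight N endpoint + 2 = weight N k" by (simp add: weight_def)
    then have *: "FX i *v raise u = (if i = k then raise u else 0)" if "i \<le> N" for i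
      using eq that X.eigenvector_F by simp
    have "k \<notin> support N FX W"
      using Suc Min_le[of "support N FX W" k] by (auto simp: endpoint_def support_def)
    then have "FX k *v raise u = 0" using Suc r raise_W[OF assms(1)] by (simp add: support_def)
    then show ?thesis using * Suc r by simp
  qed
qed

lemma span_highest:
  assumes u: "u \<in> W" "u \<noteq> 0" "X *v u = weight N endpoint *s u"
  shows "vec.span ((\<lambda>i. FY i *v u) ` {..N}) = W"
proof -
  let ?U = "vec.span ((\<lambda>i. FY i *v u) ` {..N})"
  \<comment> \<open>\<open>?U'\<close> is a \<open>Y\<close>-invariant subspace containing \<open>u\<close>, so it is all of \<open>?U\<close>.\<close>
  let ?U' = "{w \<in> ?U. X *v w \<in> ?U \<and> Z *v w \<in> ?U}"
  have U: "vec.subspace ?U" by simp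
  have base: "FY i *v u \<in> ?U" if "i \<le> N" for i using that by (auto intro: vec.span_base)
  have uU: "u \<in> ?U" using Y.sum_F[of u] base vec.span_sum by (metis (no_types, lifting) atMost_iff)
  have YU: "Y *v w \<in> ?U" if "w \<in> ?U" for w
  proof -
    have "vec.subspace {w. Y *v w \<in> ?U}"
      by (auto simp: vec.subspace_def matrix_vector_right_distrib vector_scalar_commute vec.span_add vec.span_scale vec.span_zero)
    moreover have "(\<lambda>i. FY i *v u) ` {..N} \<subseteq> {w. Y *v w \<in> ?U}"
      using base by (auto simp: Y.X_F vec.span_scale)
    ultimately show ?thesis using that vec.span_minimal by blast
  qed
  \<comment> \<open>Multiplying by \<open>c\<close> and using \<open>c * c = - 4\<close> solves
    \<open>raise u = 0\<close> for \<open>Z *v u\<close>.\<close>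
  have "c *s raise u = 0" using raise_highest u by simp
  then have "Z *v u = (c / 2) *s (Y *v u)"
    using c2 by (simp add: raise_def vec_eq_iff)
  then have "u \<in> ?U'" using uU YU u(3) by (auto intro: vec.span_scale)
  moreover have U': "vec.subspace ?U'"
    by (auto simp: vec.subspace_def matrix_vector_right_distrib vector_scalar_commute vec.span_add vec.span_scale vec.span_zero)
  \<comment> \<open>Moving \<open>X\<close> past \<open>Y\<close> produces a \<open>Z\<close> term
    and moving \<open>Z\<close> past \<open>Y\<close> an \<open>X\<close> term, so
    \<open>?U'\<close> has to impose both conditions at once.\<close>
  moreover have "Y *v w \<in> ?U'" if "w \<in> ?U'" for w
    using that YU by (auto simp: X_Y Z_Y vec.span_add vec.span_scale vec.span_diff)
  ultimately have "FY i *v u \<in> ?U'" if "i \<le> N" for i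
    using Y.F_invariant[of ?U' u i] that by blast
  then have "?U \<subseteq> ?U'" using U' by (intro vec.span_minimal) auto
  moreover have "?U \<subseteq> W"
    using Y.F_invariant[OF subspace invariant(2)] u subspace by (intro vec.span_minimal) auto
  ultimately have "?U = {0} \<or> ?U = W" using YU U by (intro irreducible) auto
  then show ?thesis using uU u by blast
qed

lemma highest_exists:
  obtains u where "u \<in> W" "u \<noteq> 0" "X *v u = weight N endpoint *s u"
proof -
  obtain w where w: "w \<in> W" "FX endpoint *v w \<noteq> 0" "endpoint \<le> N"
    using endpoint_support by (auto simp: support_def)
  moreover have "FX endpoint *v w \<in> W" using w X.F_invariant[OF subspace invariant(1)] by blast
  ultimately show ?thesis using that X.X_F by blast
qed

text \<open>Repeated lowering of a highest weight vector gives vectors \<open>v k\<close> that span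
  an invariant subspace, hence \<open>W\<close>. The place where this sequence first vanishes
  determines the last weight.\<close>

lemma support_eq: "2 * endpoint \<le> N" "support N FX W = {endpoint..N - endpoint}"
proof -
  let ?r = endpoint
  obtain u where u: "u \<in> W" "u \<noteq> 0" "X *v u = weight N ?r *s u" by (rule highest_exists)
  define v where "v k = (lower ^^ k) u" for k
  have v0: "v 0 = u" and vS: "v (Suc k) = lower (v k)" for k by (simp_all add: v_def)
  have Xv: "X *v v k = weight N (?r + k) *s v k" for k
  proof (induction k)
    case (Suc k)
    show ?case unfolding vS X_lower Suc lower_scale
      by (simp add: weight_def vec_eq_iff algebra_simps)
  qed (simp add: v0 u)
  have vW: "v k \<in> W" for k by (induction k) (simp_all add: v0 vS u lower_W)
  \<comment> \<open>The coefficient is the sum of \<open>4 * weight N (?r + j)\<close> over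
    \<open>j \<le> k\<close>, one summand from each use of \<open>raise_lower\<close>.\<close>
  have Rv: "raise (v (Suc k)) = (4 * of_nat (Suc k) * (weight N ?r - of_nat k)) *s v k" for k
  proof (induction k)
    case 0
    show ?case unfolding vS raise_lower v0 raise_highest[OF u(1,3)] u(3)
      by (simp add: lower_def)
  next
    case (Suc k)
    show ?case unfolding vS[of "Suc k"] raise_lower Suc Xv lower_scale
      unfolding vS[symmetric] by (simp add: vec_eq_iff weight_def algebra_simps)
  qed
  let ?U = "vec.span (range v)"
  have vU: "v k \<in> ?U" for k by (simp add: vec.span_base)
  have ext: "M *v w \<in> ?U" if "\<And>k. M *v v k \<in> ?U" "w \<in> ?U" for w and M :: "complex ^ 'm ^ 'm"
  proof -
    have "vec.subspace {w. M *v w \<in> ?U}"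
      by (auto simp: vec.subspace_def matrix_vector_right_distrib vector_scalar_commute vec.span_add vec.span_scale vec.span_zero)
    moreover have "range v \<subseteq> {w. M *v w \<in> ?U}" using that(1) by auto
    ultimately show ?thesis using that(2) vec.span_minimal by blast
  qed
  have R: "raise (v k) \<in> ?U" for k
    using raise_highest[OF u(1,3)] by (cases k) (simp_all add: Rv v0 vU vec.span_scale vec.span_zero)
  have L: "lower (v k) \<in> ?U" for k by (metis vS vU)
  have "?U = {0} \<or> ?U = W"
  proof (rule irreducible)
    show "?U \<subseteq> W" using vW subspace by (intro vec.span_minimal) auto
    show "X *v w \<in> ?U" if "w \<in> ?U" for w
      using that by (rule ext[rotated]) (simp add: Xv vec.span_scale vU)
    show "Y *v w \<in> ?U" if "w \<in> ?U" for w
      using that by (rule ext[rotated]) (simp add: Y_eq vec.span_scale vec.span_add R L)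
    show "Z *v w \<in> ?U" if "w \<in> ?U" for w
      using that by (rule ext[rotated]) (simp add: Z_eq vec.span_scale vec.span_diff R L)
  qed simp
  then have UW: "?U = W" using u v0 vU[of 0] by auto
  \<comment> \<open>\<open>FX (?r + k)\<close> fixes \<open>v k\<close> and kills every other
    \<open>v j\<close>, and the \<open>v j\<close> span \<open>W\<close>.\<close>
  have supp: "?r + k \<in> support N FX W \<longleftrightarrow> v k \<noteq> 0" for k
  proof
    assume "v k \<noteq> 0"
    then have "?r + k \<le> N" using X.eigenvector_high_zero[OF Xv] by (meson not_le)
    then show "?r + k \<in> support N FX W"
      using X.eigenvector_F[OF Xv, of "?r + k"] vW \<open>v k \<noteq> 0\<close> by (auto simp: support_def intro!: bexI[of _ "v k"])
  next
    assume "?r + k \<in> support N FX W"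
    then obtain w where w: "w \<in> W" "FX (?r + k) *v w \<noteq> 0" "?r + k \<le> N" by (auto simp: support_def)
    show "v k \<noteq> 0"
    proof
      assume 0: "v k = 0"
      have "vec.subspace {w. FX (?r + k) *v w = 0}"
        by (auto simp: vec.subspace_def matrix_vector_right_distrib vector_scalar_commute)
      moreover have "range v \<subseteq> {w. FX (?r + k) *v w = 0}"
        using w 0 X.eigenvector_F[OF Xv] by auto
      ultimately have "W \<subseteq> {w. FX (?r + k) *v w = 0}" using UW vec.span_minimal by blast
      then show False using w by blast
    qed
  qed
  \<comment> \<open>The index \<open>?r + Suc N\<close> is beyond \<open>N\<close>, so it is not in
    the support.\<close>
  have "\<exists>k. v k = 0" using supp[of "Suc N"] by (auto simp: support_def)
  define m where "m = (LEAST k. v k = 0)"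
  have vm: "v m = 0" unfolding m_def using \<open>\<exists>k. v k = 0\<close> by (rule LeastI_ex)
  have less: "v k \<noteq> 0" if "k < m" for k using that not_less_Least m_def by blast
  have ge: "v k = 0" if "k \<ge> m" for k
    using that by (induction rule: dec_induct) (simp_all add: vm vS lower_def)
  have "m \<noteq> 0" using vm v0 u by (metis)
  then obtain d where d: "m = Suc d" using not0_implies_Suc by blast
  \<comment> \<open>\<open>v (Suc d)\<close> is zero but \<open>v d\<close> is not, so the
    coefficient in \<open>Rv\<close> vanishes; this yields \<open>N = d + 2 * ?r\<close>.\<close>
  have "(4 * of_nat (Suc d) * (weight N ?r - of_nat d)) *s v d = 0"
    using Rv[of d] vm d by (simp add: raise_def)
  then have "4 * of_nat (Suc d) * (weight N ?r - of_nat d) = 0" using less[of d] d vec.scale_eq_0_iff by blast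
  then have "weight N ?r = of_nat d" by (simp del: of_nat_Suc)
  then have "complex_of_nat N = of_nat (d + 2 * ?r)" by (simp add: weight_def algebra_simps)
  then have N: "N = d + 2 * ?r" unfolding of_nat_eq_iff .
  then show "2 * ?r \<le> N" by simp
  have "i \<in> support N FX W \<longleftrightarrow> ?r \<le> i \<and> i \<le> N - ?r" for i
  proof (cases "?r \<le> i")
    case True
    then obtain k where k: "i = ?r + k" using le_iff_add by auto
    have "v k \<noteq> 0 \<longleftrightarrow> k \<le> d" using less ge d by (metis less_Suc_eq_le not_le)
    then show ?thesis using supp[of k] N k by simp linarith
  next
    case False
    then show ?thesis using Min_le[of "support N FX W" i] by (auto simp: endpoint_def support_def)
  qed
  then show "support N FX W = {?r..N - ?r}" unfolding atLeastAtMost_iff[symmetric] by blast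
qed

lemma dim_support: "vec.dim W = card (support N FY W)"
proof -
  obtain u where "u \<in> W" "u \<noteq> 0" "X *v u = weight N endpoint *s u" by (rule highest_exists)
  note span = span_highest[OF this]
  show ?thesis by (rule Y.cyclic_basis(4)[OF subspace invariant(2) span])
qed

end

text \<open>Each support is an interval \<open>{e..N - e}\<close> with \<open>vec.dim W\<close>
  elements, which determines \<open>e\<close>.\<close>

lemma (in sl2_module) supports_eq:
  "support N FY W = support N FX W" "support N FZ W = support N FX W"
proof -
  interpret Y: sl2_module N Y Z X FY FZ FX c W by (rule rotate)
  interpret Z: sl2_module N Z X Y FZ FX FY c W by (rule Y.rotate)
  \<comment> \<open>\<open>dim_support\<close> counts the weights of the second matrix of a triple,
    so each support is counted in the instance where its matrix comes second.\<close>
  have "N - endpoint + 1 - endpoint = vec.dim W" "N - Y.endpoint + 1 - Y.endpoint = vec.dim W"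
    "N - Z.endpoint + 1 - Z.endpoint = vec.dim W"
    using Z.dim_support Y.dim_support dim_support support_eq Y.support_eq Z.support_eq by simp_all
  then have "Y.endpoint = endpoint" "Z.endpoint = endpoint"
    using support_eq(1) Y.support_eq(1) Z.support_eq(1) by simp_all
  then show "support N FY W = support N FX W" "support N FZ W = support N FX W"
    using support_eq Y.support_eq Z.support_eq by simp_all
qed

lemma (in sl2_module) basis_highest:
  assumes "u \<in> (\<lambda>w. FX r *v w) ` W" "u \<noteq> 0" "r = Min (support N FX W)"
  shows "inj_on (\<lambda>i. FY i *v u) (support N FX W)"
    and "vec.independent ((\<lambda>i. FY i *v u) ` support N FX W)"
    and "vec.span ((\<lambda>i. FY i *v u) ` support N FX W) = W"
proof -
  have r: "r = endpoint" "r \<le> N"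
    using assms(3) endpoint_support by (auto simp: endpoint_def support_def)
  have "u \<in> W" using assms(1) r X.F_invariant[OF subspace invariant(1)] by blast
  moreover have "X *v u = weight N endpoint *s u" using assms(1) r X.X_F by blast
  ultimately have span: "vec.span ((\<lambda>i. FY i *v u) ` {..N}) = W" using assms(2) span_highest by blast
  show "inj_on (\<lambda>i. FY i *v u) (support N FX W)"
    "vec.independent ((\<lambda>i. FY i *v u) ` support N FX W)"
    "vec.span ((\<lambda>i. FY i *v u) ` support N FX W) = W"
    using Y.cyclic_basis(1-3)[OF subspace invariant(2) span] by (simp_all add: supports_eq)
qed

section \<open>Distance and neighbours in the cube\<close>

lemma bit_cases: "(a::2) = 0 \<or> a = 1"
  using exhaust_2[of a] by auto

lemma bit_add_one: "(a::2) + 1 = 0 \<longleftrightarrow> a = 1" "(a::2) + 1 = 1 \<longleftrightarrow> a = 0"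
  using bit_cases[of a] by auto

lemma bit_neq_iff: "(a::2) \<noteq> b \<longleftrightarrow> b = a + 1"
  using bit_cases[of a] bit_cases[of b] by auto

lemma sum_bit: "(\<Sum>b\<in>UNIV. f (b::2)) = f 0 + f 1"
proof -
  have UNIV: "(UNIV :: 2 set) = {0, 1}" using bit_cases by auto
  show ?thesis unfolding UNIV by simp
qed

lemma card_Suc_differ_update:
  fixes y z :: "('n::finite) vertex"
  assumes "y $ k \<noteq> z $ k"
  defines "y' \<equiv> (\<chi> j. if j = k then z $ j else y $ j)"
  shows "cube_adj y y'" "card {j. y $ j \<noteq> z $ j} = Suc (card {j. y' $ j \<noteq> z $ j})"
proof -
  have "{j. y $ j \<noteq> y' $ j} = {k}" using assms by auto
  then show "cube_adj y y'" by (simp add: cube_adj_def)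
  have "{j. y $ j \<noteq> z $ j} = insert k {j. y' $ j \<noteq> z $ j}" using assms by auto
  moreover have "k \<notin> {j. y' $ j \<noteq> z $ j}" by (simp add: y'_def)
  ultimately show "card {j. y $ j \<noteq> z $ j} = Suc (card {j. y' $ j \<noteq> z $ j})" by simp
qed

text \<open>Correcting the differing coordinates one at a time gives a walk of this length;
  conversely, each edge changes the number of differing coordinates by at most one.\<close>

lemma cube_dist_eq: "cube_dist y z = card {k. y $ k \<noteq> z $ k}"
  unfolding cube_dist_def
proof (rule Least_equality)
  show "(cube_adj ^^ card {k. y $ k \<noteq> z $ k}) y z"
  proof (induction "card {k. y $ k \<noteq> z $ k}" arbitrary: y)
    case 0
    then have "y = z" by (simp add: vec_eq_iff)
    then show ?case by simp
  next
    case (Suc m)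
    then obtain k where k: "y $ k \<noteq> z $ k" by fastforce
    let ?y = "\<chi> j. if j = k then z $ j else y $ j"
    note y = card_Suc_differ_update[OF k]
    have "(cube_adj ^^ m) ?y z" using Suc.hyps(1)[of ?y] y(2) Suc.hyps(2) by simp
    with y(1) have "(cube_adj ^^ Suc m) y z" by (rule relpowp_Suc_I2)
    then show ?case by (simp only: Suc.hyps(2))
  qed
next
  fix m assume "(cube_adj ^^ m) y z"
  then show "card {k. y $ k \<noteq> z $ k} \<le> m"
  proof (induction m arbitrary: z)
    case (Suc m)
    then obtain w where w: "(cube_adj ^^ m) y w" "cube_adj w z" by auto
    have "card {k. y $ k \<noteq> z $ k} \<le> card ({k. y $ k \<noteq> w $ k} \<union> {k. w $ k \<noteq> z $ k})"
      by (intro card_mono) auto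
    also have "\<dots> \<le> m + 1"
      using Suc.IH[OF w(1)] w(2) card_Un_le[of "{k. y $ k \<noteq> w $ k}" "{k. w $ k \<noteq> z $ k}"]
      by (simp add: cube_adj_def)
    finally show ?case by simp
  qed simp
qed

text \<open>Indexes the neighbours of \<open>y\<close> by coordinates, so that products with
  \<open>adj_mat\<close> become sums over \<open>k\<close>. Addition in the type \<open>2\<close> is
  modulo 2.\<close>

definition flip :: "('n::finite) vertex \<Rightarrow> 'n \<Rightarrow> 'n vertex" where
  "flip y k = (\<chi> j. if j = k then y $ j + 1 else y $ j)"

lemma cube_adj_iff_flip: "cube_adj y z \<longleftrightarrow> z \<in> range (flip y)"
proof
  assume "cube_adj y z"
  then obtain k where "{j. y $ j \<noteq> z $ j} = {k}" by (auto simp: cube_adj_def card_1_singleton_iff)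
  then have differ: "y $ j \<noteq> z $ j \<longleftrightarrow> j = k" for j by blast
  have "z $ j = flip y k $ j" for j
  proof (cases "j = k")
    case True
    then have "z $ j = y $ j + 1" using differ bit_neq_iff by blast
    then show ?thesis using True by (simp add: flip_def)
  next
    case False
    then show ?thesis using differ[of j] by (simp add: flip_def)
  qed
  then have "z = flip y k" by (simp add: vec_eq_iff)
  then show "z \<in> range (flip y)" by blast
next
  assume "z \<in> range (flip y)"
  then obtain k where "z = flip y k" by blast
  then have "{j. y $ j \<noteq> z $ j} = {k}" by (auto simp: flip_def)
  then show "cube_adj y z" by (simp add: cube_adj_def)
qed

lemma cube_adj_commute: "cube_adj y z \<longleftrightarrow> cube_adj z y"
  by (simp add: cube_adj_def eq_commute)

lemma inj_flip: "inj (flip y)"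
  by (rule injI) (auto simp: flip_def vec_eq_iff split: if_splits)

lemma sum_cube_adj:
  fixes f :: "('n::finite) vertex \<Rightarrow> complex"
  shows "(\<Sum>z\<in>UNIV. (if cube_adj y z then f z else 0)) = (\<Sum>k\<in>UNIV. f (flip y k))"
proof -
  have "(\<Sum>z\<in>UNIV. (if cube_adj y z then f z else 0)) = sum f (range (flip y))"
    by (rule sum.mono_neutral_cong_right) (auto simp: cube_adj_iff_flip)
  then show ?thesis by (simp add: sum.reindex[OF inj_flip])
qed

section \<open>Entries of the three matrices\<close>

definition bit_sign :: "2 \<Rightarrow> complex" where
  "bit_sign a = (if a = 0 then 1 else - 1)"

text \<open>The diagonal entry of \<open>dual_adj_mat\<close> as a sum over coordinates, to be
  compared termwise with sums over flips.\<close>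

definition vertex_weight :: "('n::finite) vertex \<Rightarrow> complex" where
  "vertex_weight y = (\<Sum>k\<in>UNIV. bit_sign (y $ k))"

lemma theta_cube_dist:
  fixes y :: "('n::finite) vertex"
  shows "theta TYPE('n) (cube_dist 0 y) = vertex_weight y"
proof -
  have "vertex_weight y = (\<Sum>k\<in>UNIV. 1 - 2 * of_bool (y $ k \<noteq> 0))"
    unfolding vertex_weight_def by (rule sum.cong) (auto simp: bit_sign_def)
  also have "\<dots> = of_nat CARD('n) - 2 * of_nat (card {k. y $ k \<noteq> 0})"
    unfolding sum_subtractf sum_distrib_left[symmetric] by (simp add: sum_of_bool_eq)
  finally show ?thesis by (simp add: theta_def cube_dist_eq eq_commute[of 0])
qed

lemma vertex_weight_flip: "vertex_weight (flip y k) = vertex_weight y - 2 * bit_sign (y $ k)"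
proof -
  have "vertex_weight (flip y k) = bit_sign (y $ k + 1) + (\<Sum>j\<in>UNIV - {k}. bit_sign (y $ j))"
    unfolding vertex_weight_def by (subst sum.remove[of _ k]) (auto simp: flip_def intro!: sum.cong)
  moreover have "vertex_weight y = bit_sign (y $ k) + (\<Sum>j\<in>UNIV - {k}. bit_sign (y $ j))"
    unfolding vertex_weight_def by (rule sum.remove) auto
  moreover have "bit_sign (y $ k + 1) = - bit_sign (y $ k)"
    by (simp add: bit_sign_def bit_add_one) (use bit_cases in auto)
  ultimately show ?thesis by simp
qed

definition adj_eps :: "('n::finite) cmatrix" where
  "adj_eps = mat_scale (- \<i> / 2) (adj_mat ** dual_adj_mat - dual_adj_mat ** adj_mat)"

lemma dual_adj_mat_nth: "dual_adj_mat $ y $ z = (if y = z then vertex_weight y else 0)"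
  by (simp add: dual_adj_mat_def theta_cube_dist)

lemma mult_dual: "(M ** dual_adj_mat) $ y $ z = M $ y $ z * vertex_weight z"
  and dual_mult: "(dual_adj_mat ** M) $ y $ z = vertex_weight y * M $ y $ z"
  by (simp_all add: matrix_matrix_mult_def dual_adj_mat_nth if_distrib[of "\<lambda>a. a * _"]
      if_distrib[of "\<lambda>a. _ * a"] cong: if_cong)

lemma adj_eps_nth:
  "adj_eps $ y $ z = (if cube_adj y z then - \<i> / 2 * (vertex_weight z - vertex_weight y) else 0)"
  by (simp add: adj_eps_def mat_scale_def mult_dual dual_mult) (simp add: adj_mat_def)

lemma adj_mult: "(adj_mat ** M) $ y $ z = (\<Sum>k\<in>UNIV. M $ flip y k $ z)"
  and mult_adj: "(M ** adj_mat) $ y $ z = (\<Sum>k\<in>UNIV. M $ y $ flip z k)"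
  by (simp_all add: matrix_matrix_mult_def adj_mat_def if_distrib[of "\<lambda>a. a * _"] cube_adj_commute[of _ z]
      if_distrib[of "\<lambda>a. _ * a"] sum_cube_adj cong: if_cong)

text \<open>By \<open>vertex_weight_flip\<close>, the entry of \<open>adj_eps\<close> at row
  \<open>y\<close> and column \<open>flip y k\<close> is \<open>\<i> * bit_sign (y $ k)\<close>; the
  opposite entry has the opposite sign.\<close>

lemma adj_eps_mult: "(adj_eps ** M) $ y $ z = (\<Sum>k\<in>UNIV. \<i> * bit_sign (y $ k) * M $ flip y k $ z)"
  and mult_adj_eps: "(M ** adj_eps) $ y $ z = (\<Sum>k\<in>UNIV. - \<i> * bit_sign (z $ k) * M $ y $ flip z k)"
  by (simp_all add: matrix_matrix_mult_def adj_eps_nth if_distrib[of "\<lambda>a. a * _"] cube_adj_commute[of _ z]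
      if_distrib[of "\<lambda>a. _ * a"] sum_cube_adj vertex_weight_flip mult_ac cong: if_cong)

section \<open>Conjugation by \<open>P\<close>\<close>

lemma P_remove: "P $ y $ z = P1 $ (y $ k) $ (z $ k) * (\<Prod>j\<in>UNIV - {k}. P1 $ (y $ j) $ (z $ j))"
  by (simp add: P_def prod.remove[of _ k])

text \<open>A flip at \<open>k\<close> affects only the factor at \<open>k\<close>, so each identity
  reduces to four cases for \<open>P1\<close>. Summed over \<open>k\<close>, they give
  \<open>P_adj\<close>, \<open>P_dual\<close> and \<open>P_adj_eps\<close>.\<close>

lemma P_flip_right: "P $ y $ flip z k = bit_sign (y $ k) * P $ y $ z"
  and P_flip_left: "\<i> * bit_sign (y $ k) * P $ flip y k $ z = bit_sign (z $ k) * P $ y $ z"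
  and P_flip_left_right: "- \<i> * bit_sign (z $ k) * P $ y $ flip z k = P $ flip y k $ z"
  unfolding P_remove[where k = k] using bit_cases[of "y $ k"] bit_cases[of "z $ k"]
  by (auto simp: flip_def P1_def bit_sign_def cong: prod.cong_simp)

lemma P_adj: "P ** adj_mat = dual_adj_mat ** P"
  by (simp add: vec_eq_iff mult_adj dual_mult P_flip_right vertex_weight_def sum_distrib_right)

lemma P_dual: "P ** dual_adj_mat = adj_eps ** P"
  by (simp add: vec_eq_iff mult_dual adj_eps_mult P_flip_left vertex_weight_def sum_distrib_left
      mult.commute)

lemma P_adj_eps: "P ** adj_eps = adj_mat ** P"
  unfolding vec_eq_iff mult_adj_eps adj_mult P_flip_left_right by simp

lemma invertible_P: "invertible (P :: ('n::finite) cmatrix)"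
proof -
  \<comment> \<open>The rows of \<open>P1\<close> are orthogonal with squared norm 2, so half its
    conjugate transpose is its inverse; \<open>Q\<close> is the Kronecker power of that.\<close>
  define Q :: "'n cmatrix" where "Q = (\<chi> y z. \<Prod>k\<in>UNIV. cnj (P1 $ (z $ k) $ (y $ k)) / 2)"
  have "(P ** Q) $ y $ z = mat 1 $ y $ z" for y z
  proof -
    let ?f = "\<lambda>k b. P1 $ (y $ k) $ b * (cnj (P1 $ (z $ k) $ b) / 2)"
    have "(P ** Q) $ y $ z = (\<Sum>w\<in>UNIV. \<Prod>k\<in>UNIV. ?f k (w $ k))"
      by (simp only: matrix_matrix_mult_def P_def Q_def prod.distrib vec_lambda_beta)
    \<comment> \<open>Vertices are viewed as functions so that the sum of products factors over the
      coordinates.\<close>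
    also have "\<dots> = (\<Sum>g\<in>UNIV. \<Prod>k\<in>UNIV. ?f k (g k))"
      by (rule sum.reindex_bij_witness[of _ vec_lambda vec_nth]) auto
    also have "\<dots> = (\<Prod>k\<in>UNIV. \<Sum>b\<in>UNIV. ?f k b)"
      by (subst prod_sum_PiE) auto
    also have "\<dots> = (\<Prod>k\<in>UNIV. of_bool (y $ k = z $ k))"
    proof (rule prod.cong[OF refl])
      show "(\<Sum>b\<in>UNIV. ?f k b) = of_bool (y $ k = z $ k)" for k
        unfolding sum_bit using bit_cases[of "y $ k"] bit_cases[of "z $ k"] by (auto simp: P1_def)
    qed
    also have "\<dots> = mat 1 $ y $ z" by (auto simp: mat_def vec_eq_iff)
    finally show ?thesis .
  qed
  then show ?thesis by (metis invertible_right_inverse vec_eq_iff)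
qed

lemma matrix_inv_mult:
  fixes Q :: "complex ^ 'm ^ 'm"
  assumes "invertible Q"
  shows "Q ** matrix_inv Q = mat 1" "matrix_inv Q ** Q = mat 1"
  using assms someI_ex[of "\<lambda>M. Q ** M = mat 1 \<and> M ** Q = mat 1"]
  unfolding invertible_def matrix_inv_def by blast+

text \<open>\<open>X'\<close> is the conjugate of \<open>X\<close> by \<open>Q\<close>, so its
  spectral decomposition is the conjugate one.\<close>

lemma spectral_conjugate:
  fixes X X' Q :: "complex ^ 'm ^ 'm"
  assumes "spectral N X F" "invertible Q" "Q ** X' = X ** Q"
  shows "spectral N X' (\<lambda>i. matrix_inv Q ** F i ** Q)"
proof -
  interpret spectral N X F by fact
  have Q: "matrix_inv Q *v (Q *v v) = v" "Q *v (matrix_inv Q *v v) = v" for v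
    using assms(2) by (simp_all add: matrix_vector_mul_assoc matrix_inv_mult)
  have *: "Q *v (X' *v v) = X *v (Q *v v)" for v
    using assms(3) by (simp add: matrix_vector_mul_assoc)
  have X': "X' *v v = matrix_inv Q *v (X *v (Q *v v))" for v
    by (metis * Q(1))
  show ?thesis
  proof unfold_locales
    fix v
    have "(\<Sum>i\<le>N. (matrix_inv Q ** F i ** Q) *v v) = matrix_inv Q *v (\<Sum>i\<le>N. F i *v (Q *v v))"
      by (simp add: vec.linear_sum[OF matrix_vector_mul_linear_gen] matrix_vector_mul_assoc matrix_mul_assoc)
    then show "(\<Sum>i\<le>N. (matrix_inv Q ** F i ** Q) *v v) = v" by (simp add: sum_F Q)
    show "X' *v ((matrix_inv Q ** F i ** Q) *v v) = weight N i *s ((matrix_inv Q ** F i ** Q) *v v)"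
      if "i \<le> N" for i
      using that unfolding matrix_vector_mul_assoc[symmetric] X'
      by (simp add: Q X_F vector_scalar_commute)
  qed
qed

section \<open>Spectral decompositions of the three matrices\<close>

lemma weight_theta: "weight CARD('n) i = theta TYPE('n::finite) i"
  by (simp add: weight_def theta_def)

lemma E_star_vec: "(E_star i *v v) $ y = (if cube_dist 0 y = i then v $ y else 0)"
  by (simp add: matrix_vector_mult_def E_star_def if_distrib[of "\<lambda>a. a * _"] if_bool_eq_conj cong: if_cong)

lemma dual_adj_vec:
  fixes v :: "('n::finite) cvector"
  shows "(dual_adj_mat *v v) $ y = theta TYPE('n) (cube_dist 0 y) * v $ y"
  by (simp add: matrix_vector_mult_def dual_adj_mat_def if_distrib[of "\<lambda>a. a * _"] cong: if_cong)

lemma spectral_E_star: "spectral CARD('n) dual_adj_mat (E_star :: nat \<Rightarrow> ('n::finite) cmatrix)"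
proof unfold_locales
  fix v :: "'n cvector"
  have "cube_dist 0 y \<le> CARD('n)" for y :: "'n vertex"
    by (simp add: cube_dist_eq card_mono)
  then show "(\<Sum>i\<le>CARD('n). E_star i *v v) = v"
    by (simp add: vec_eq_iff E_star_vec)
  show "dual_adj_mat *v (E_star i *v v) = weight CARD('n) i *s (E_star i *v v)" for i
    by (simp add: vec_eq_iff E_star_vec dual_adj_vec weight_theta)
qed

lemma mat_scale_vec: "mat_scale a M *v v = a *s (M *v v)"
  by (simp add: vec_eq_iff mat_scale_def matrix_vector_mult_def sum_distrib_left mult.assoc)

lemma mat_vec: "mat a *v v = a *s v"
  by (simp add: vec_eq_iff mat_def matrix_vector_mult_def if_distrib[of "\<lambda>a. a * _"] cong: if_cong)

lemma foldr_eigenvector: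
  fixes X :: "('n::finite) cmatrix"
  assumes "X *v v = \<mu> *s v"
  shows "foldr (**) (map (\<lambda>j. mat_scale (a j) (X - mat (t j))) js) (mat 1) *v v
    = (\<Prod>j\<leftarrow>js. a j * (\<mu> - t j)) *s v"
proof (induction js)
  case (Cons j js)
  have "mat_scale (a j) (X - mat (t j)) *v v = (a j * (\<mu> - t j)) *s v"
    using assms by (simp add: mat_scale_vec matrix_vector_mult_diff_rdistrib mat_vec vec.scale_right_diff_distrib algebra_simps)
  then show ?case using Cons
    by (simp add: matrix_vector_mul_assoc[symmetric] vector_scalar_commute vector_smult_assoc mult.commute)
qed simp

text \<open>The scalar is a Lagrange polynomial evaluated at the \<open>k\<close>-th eigenvalue: for
  \<open>i = k\<close> all factors are 1, otherwise the factor for \<open>j = k\<close>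
  vanishes.\<close>

lemma E_eigenvector:
  fixes v :: "('n::finite) cvector"
  assumes "adj_mat *v v = theta TYPE('n) k *s v" "k \<le> CARD('n)"
  shows "E i *v v = (if i = k then v else 0)"
proof -
  let ?js = "filter (\<lambda>j. j \<noteq> i) [0..<CARD('n) + 1]"
  let ?g = "\<lambda>j. 1 / (theta TYPE('n) i - theta TYPE('n) j) * (theta TYPE('n) k - theta TYPE('n) j)"
  have "(\<Prod>j\<leftarrow>?js. ?g j) = (if i = k then 1 else 0)"
  proof (cases "i = k")
    case True
    have "(\<Prod>j\<leftarrow>js. ?g j) = 1" if "\<forall>j\<in>set js. ?g j = 1" for js
      using that by (induction js) auto
    moreover have "\<forall>j\<in>set ?js. ?g j = 1" by (simp add: True weight_theta[symmetric] del: upt_Suc)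
    ultimately show ?thesis using True by simp
  next
    case False
    have zero: "0 = ?g k" by simp
    have "k \<in> set ?js" unfolding set_filter set_upt using False assms(2) by simp
    with zero have "0 \<in> set (map ?g ?js)" unfolding set_map by (rule image_eqI)
    then show ?thesis using False by (simp only: prod_list_zero_iff if_False)
  qed
  then show ?thesis unfolding E_def foldr_eigenvector[OF assms(1)] by simp
qed

text \<open>Conjugating the diagonal matrix \<open>dual_adj_mat\<close> shows that every vector is a
  sum of eigenvectors of \<open>adj_mat\<close>; on these, \<open>E i\<close> acts as the conjugated
  idempotent.\<close>

lemma spectral_E: "spectral CARD('n) adj_mat (E :: nat \<Rightarrow> ('n::finite) cmatrix)"
proof -
  define F :: "nat \<Rightarrow> 'n cmatrix" where "F i = matrix_inv P ** E_star i ** P" for i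
  interpret F: spectral "CARD('n)" adj_mat F
    unfolding F_def by (rule spectral_conjugate[OF spectral_E_star invertible_P P_adj])
  have *: "E i *v v = F i *v v" if "i \<le> CARD('n)" for i v
  proof -
    have "E i *v v = E i *v (\<Sum>k\<le>CARD('n). F k *v v)" by (simp only: F.sum_F)
    also have "\<dots> = (\<Sum>k\<le>CARD('n). if i = k then F k *v v else 0)"
      unfolding vec.linear_sum[OF matrix_vector_mul_linear_gen]
      by (intro sum.cong refl E_eigenvector) (simp_all add: F.X_F weight_theta)
    finally show ?thesis using that by simp
  qed
  show ?thesis by unfold_locales (simp_all add: * F.sum_F F.X_F)
qed

lemma spectral_E_eps: "spectral CARD('n) adj_eps (E_eps :: nat \<Rightarrow> ('n::finite) cmatrix)"
  using spectral_conjugate[OF spectral_E invertible_P P_adj_eps] by (simp add: E_eps_def[abs_def])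

section \<open>Commutators and \<open>T\<close>-modules\<close>

lemma adj_dual_commutator:
  "adj_mat *v (dual_adj_mat *v v) - dual_adj_mat *v (adj_mat *v v) = (2 * \<i>) *s (adj_eps *v v)"
  by (simp add: adj_eps_def mat_scale_vec matrix_vector_mult_diff_rdistrib matrix_vector_mul_assoc vector_smult_assoc
      vec.scale_right_diff_distrib)

lemma P_vec:
  "P *v (adj_mat *v v) = dual_adj_mat *v (P *v v)"
  "P *v (dual_adj_mat *v v) = adj_eps *v (P *v v)"
  "P *v (adj_eps *v v) = adj_mat *v (P *v v)"
  by (simp_all add: matrix_vector_mul_assoc P_adj P_dual P_adj_eps)

lemma P_vec_surj: "\<exists>w. v = P *v w"
  using matrix_inv_mult(1)[OF invertible_P] by (metis matrix_vector_mul_assoc matrix_vector_mul_lid)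

text \<open>\<open>P\<close> carries the previous commutator relation to this one; surjectivity of
  \<open>P\<close> makes \<open>v\<close> arbitrary.\<close>

lemma dual_eps_commutator:
  "dual_adj_mat *v (adj_eps *v v) - adj_eps *v (dual_adj_mat *v v) = (2 * \<i>) *s (adj_mat *v v)"
proof -
  obtain w where v: "v = P *v w" using P_vec_surj by blast
  from arg_cong[OF adj_dual_commutator[of w], of "\<lambda>x. P *v x"] show ?thesis
    unfolding v by (simp add: matrix_vector_mult_diff_distrib vector_scalar_commute P_vec)
qed

lemma eps_adj_commutator:
  "adj_eps *v (adj_mat *v v) - adj_mat *v (adj_eps *v v) = (2 * \<i>) *s (dual_adj_mat *v v)"
proof -
  obtain w where v: "v = P *v w" using P_vec_surj by blast
  from arg_cong[OF dual_eps_commutator[of w], of "\<lambda>x. P *v x"] show ?thesis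
    unfolding v by (simp add: matrix_vector_mult_diff_distrib vector_scalar_commute P_vec)
qed

lemma is_subalgebra_stabilizer:
  assumes "vec.subspace U"
  shows "is_subalgebra {B. \<forall>w\<in>U. B *v w \<in> U}"
  unfolding is_subalgebra_def using assms
  by (auto simp: mat_scale_vec matrix_vector_mult_add_rdistrib matrix_vector_mul_assoc[symmetric]
      intro: vec.subspace_add vec.subspace_scale)

text \<open>The matrices preserving a subspace form a subalgebra, so it is enough to test the two
  generators.\<close>

lemma T_module_iff:
  "T_module U \<longleftrightarrow> vec.subspace U \<and> (\<forall>w\<in>U. adj_mat *v w \<in> U) \<and> (\<forall>w\<in>U. dual_adj_mat *v w \<in> U)"
proof
  assume "T_module U"
  moreover have "adj_mat \<in> T_alg" "dual_adj_mat \<in> T_alg"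
    unfolding T_alg_def by (auto intro: hull_inc)
  ultimately show "vec.subspace U \<and> (\<forall>w\<in>U. adj_mat *v w \<in> U) \<and> (\<forall>w\<in>U. dual_adj_mat *v w \<in> U)"
    by (auto simp: T_module_def)
next
  assume U: "vec.subspace U \<and> (\<forall>w\<in>U. adj_mat *v w \<in> U) \<and> (\<forall>w\<in>U. dual_adj_mat *v w \<in> U)"
  then have "T_alg \<subseteq> {B. \<forall>w\<in>U. B *v w \<in> U}"
    unfolding T_alg_def by (intro hull_minimal is_subalgebra_stabilizer) auto
  then show "T_module U" using U by (auto simp: T_module_def)
qed

lemma irreducible_T_module_sl2:
  fixes W :: "('n::finite) cvector set"
  assumes "irreducible_T_module W"
  shows "sl2_module CARD('n) adj_mat dual_adj_mat adj_eps E E_star E_eps (2 * \<i>) W"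
proof (rule sl2_module.intro)
  have W: "vec.subspace W" "\<And>w. w \<in> W \<Longrightarrow> adj_mat *v w \<in> W" "\<And>w. w \<in> W \<Longrightarrow> dual_adj_mat *v w \<in> W"
    using assms by (auto simp: irreducible_T_module_def T_module_iff)
  \<comment> \<open>\<open>adj_eps\<close> is a combination of products of the two
    generators.\<close>
  have eps: "adj_eps *v w \<in> W" if "w \<in> W" for w
    using that W by (auto simp: adj_eps_def mat_scale_vec matrix_vector_mult_diff_rdistrib matrix_vector_mul_assoc[symmetric]
        intro!: vec.subspace_diff vec.subspace_scale)
  show "sl2_module_axioms adj_mat dual_adj_mat adj_eps (2 * \<i>) W"
  proof
    fix U assume "vec.subspace U" "U \<subseteq> W" "\<And>w. w \<in> U \<Longrightarrow> adj_mat *v w \<in> U"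
      "\<And>w. w \<in> U \<Longrightarrow> dual_adj_mat *v w \<in> U"
    then show "U = {0} \<or> U = W" using assms by (auto simp: irreducible_T_module_def T_module_iff)
  qed (use assms in \<open>simp_all add: W eps adj_dual_commutator dual_eps_commutator eps_adj_commutator
        irreducible_T_module_def\<close>)
qed (rule spectral_E spectral_E_star spectral_E_eps)+

lemma module_support_eq:
  fixes W :: "('n::finite) cvector set"
  assumes "vec.subspace W"
  shows "module_support W = support CARD('n) E_star W"
proof -
  have "mat_image M W \<noteq> {0} \<longleftrightarrow> (\<exists>w\<in>W. M *v w \<noteq> 0)" for M
    \<comment> \<open>\<open>0 \<in> W\<close> rules out an empty image.\<close>
    using vec.subspace_0[OF assms] by (force simp: mat_image_def)
  then show ?thesis by (simp add: module_support_def support_def)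
qed

section \<open>The six bases\<close>

theorem lemma9p1:
  fixes W :: "(complex ^ (2 ^ 'n::finite)) set" and r d :: nat
  assumes "irreducible_T_module W"
    and "r = module_endpoint W"
    and "d = module_diameter W"
  shows
    "(\<forall>u \<in> mat_image (E r) W. u \<noteq> 0 \<longrightarrow>
        is_basis (map (\<lambda>i. E_star i *v u) [r..<r + d + 1]) W \<and>
        is_basis (map (\<lambda>i. E_eps i *v u) [r..<r + d + 1]) W) \<and>
     (\<forall>u \<in> mat_image (E_star r) W. u \<noteq> 0 \<longrightarrow>
        is_basis (map (\<lambda>i. E_eps i *v u) [r..<r + d + 1]) W \<and>
        is_basis (map (\<lambda>i. E i *v u) [r..<r + d + 1]) W) \<and>
     (\<forall>u \<in> mat_image (E_eps r) W. u \<noteq> 0 \<longrightarrow>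
        is_basis (map (\<lambda>i. E i *v u) [r..<r + d + 1]) W \<and>
        is_basis (map (\<lambda>i. E_star i *v u) [r..<r + d + 1]) W)"
proof -
  let ?N = "CARD('n)"
  \<comment> \<open>The six orderings of the three matrices correspond to the six bases: the first
    matrix supplies the highest weight vector, the second the projections.\<close>
  interpret A: sl2_module ?N adj_mat dual_adj_mat adj_eps E E_star E_eps "2 * \<i>" W
    by (rule irreducible_T_module_sl2) fact
  interpret As: sl2_module ?N dual_adj_mat adj_eps adj_mat E_star E_eps E "2 * \<i>" W by (rule A.rotate)
  interpret Ae: sl2_module ?N adj_eps adj_mat dual_adj_mat E_eps E E_star "2 * \<i>" W by (rule As.rotate)
  interpret A': sl2_module ?N adj_mat adj_eps dual_adj_mat E E_eps E_star "- (2 * \<i>)" W by (rule A.reflect)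
  interpret As': sl2_module ?N dual_adj_mat adj_mat adj_eps E_star E E_eps "- (2 * \<i>)" W by (rule As.reflect)
  interpret Ae': sl2_module ?N adj_eps dual_adj_mat adj_mat E_eps E_star E "- (2 * \<i>)" W by (rule Ae.reflect)
  \<comment> \<open>Endpoint and diameter are defined through \<open>E_star\<close>; equality of
    supports transfers them to \<open>E\<close>.\<close>
  have S: "module_support W = support ?N E W"
    by (simp add: module_support_eq[OF A.subspace] A.supports_eq)
  have r: "r = Min (support ?N E W)" using assms(2) by (simp add: module_endpoint_def S)
  then have re: "r = A.endpoint" by (simp add: A.endpoint_def)
  have supp: "2 * r \<le> ?N" "support ?N E W = {r..?N - r}" unfolding re by (rule A.support_eq)+
  have "d = card {r..?N - r} - 1" using assms(3) by (simp only: module_diameter_def S supp(2))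
  \<comment> \<open>As \<open>2 * r \<le> ?N\<close>, the interval is nonempty and the truncated
    subtractions are exact.\<close>
  then have "?N - r = r + d" using supp(1) by simp
  then have "support ?N E W = {r..r + d}" using supp(2) by (simp only:)
  then have list: "set [r..<r + d + 1] = support ?N E W"
    by (simp only: set_upt atLeastLessThanSuc_atLeastAtMost flip: Suc_eq_plus1)
  have basis: "is_basis (map (\<lambda>i. F i *v u) [r..<r + d + 1]) W"
    if "inj_on (\<lambda>i. F i *v u) (support ?N E W)"
      "vec.independent ((\<lambda>i. F i *v u) ` support ?N E W)"
      "vec.span ((\<lambda>i. F i *v u) ` support ?N E W) = W" for F and u
    using that unfolding is_basis_def distinct_map set_map list by simp
  note highest = A.basis_highest A'.basis_highest As.basis_highest As'.basis_highest
    Ae.basis_highest Ae'.basis_highest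
  note highest = highest[unfolded A.supports_eq]
  show ?thesis
    unfolding mat_image_def
    by (intro conjI ballI impI basis; (rule highest, assumption, assumption, rule r))
qed

end
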